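(* Let $X$ be a metrizable, separable, locally compact space, let $\mathcal F=\{f_1,\dots,f_m\}$ be an iterated function system on $X$ with compact dynamics, and let $N$ be an orbitwise chain node of $\mathcal F$. Then $N$ is forward-invariant, and $\Omega_{\mathcal F}(N)$ is the greatest (with respect to inclusion) non-empty compact $H$-invariant subset of $N$.
   Context: Fix any metric $d$ on $X$ compatible with its topology. An iterated function system (IFS) on $X$ is a finite collection $\mathcal F=\{f_1,\dots,f_m\}$, $m\ge1$, of continuous maps $X\to X$. $\mathcal I^m$ is the set of all finite words in the letters $1,\dots,m$ (including the empty word $0$); $|I|$ is the length of $I$. For $I=i_1\cdots i_k$, $\Phi^I_{\mathcal F}=f_{i_k}\circ\dots\circ f_{i_1}$, and $\Phi^0_{\mathcal F}=\mathrm{id}_X$. For $A\subset X$, $H_{\mathcal F}(A)=\bigcup_{i=1}^m f_i(A)$. $A$ is forward-invariant if $f_i(A)\subset A$ for every $i$, and $H$-invariant if $H_{\mathcal F}(A)=A$. The orbit of $x$ is $\mathcal O_{\mathcal F}(x)=\{\Phi^I_{\mathcal F}(x): I\in\mathcal I^m\}$. $\Omega_{\mathcal F}(A)$ is the set of $y\in X$ for which there are $I_n\in\mathcal I^m$ and $a_n\in A$ with $|I_n|\to\infty$ and $\Phi^{I_n}_{\mathcal F}(a_n)\to y$. $N_\varepsilon(A)=\{x:d(x,A)<\varepsilon\}$. $A$ attracts $K$ if for every $\varepsilon>0$ there is $\tau>0$ with $\Phi^I_{\mathcal F}(K)\subset N_\varepsilon(A)$ for every $|I|\ge\tau$. A global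 attractor is a compact $H$-invariant set that attracts every compact subset of $X$. $\mathcal F$ has compact dynamics if it has a global attractor. Chains: an $\varepsilon$-chain from $x$ to $y$ is a finite sequence $x_0=x,x_1,\dots,x_k=y$ ($k\ge0$) in $X$ with indices $i_0,\dots,i_{k-1}$ such that $d(f_{i_n}(x_n),x_{n+1})<\varepsilon$ for $n=0,\dots,k-1$. Write $x\succcurlyeq y$ if for every $\varepsilon>0$ there is an $\varepsilon$-chain from $x$ to $y$; $x,y$ are chain-equivalent if $x\succcurlyeq y$ and $y\succcurlyeq x$. A point $x$ is orbitwise chain-recurrent if it is chain-equivalent to every point of $\mathcal O_{\mathcal F}(x)$. Orbitwise chain nodes are the chain-equivalence classes of the set of orbitwise chain-recurrent points. *)

theory Defs
  imports "HOL-Analysis.Analysis"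
begin

definition ifs :: "nat \<Rightarrow> (nat \<Rightarrow> 'a::topological_space \<Rightarrow> 'a) \<Rightarrow> bool" where
  "ifs m f \<longleftrightarrow> 1 \<le> m \<and> (\<forall>i\<in>{1..m}. continuous_on UNIV (f i))"

definition ifs_words :: "nat \<Rightarrow> nat list set" where
  "ifs_words m = {I. set I \<subseteq> {1..m}}"

text \<open>The head of a word is applied first: the word i1 i2 ... ik acts as
  \<open>f ik \<circ> ... \<circ> f i2 \<circ> f i1\<close>.\<close>

fun ifs_Phi :: "(nat \<Rightarrow> 'a \<Rightarrow> 'a) \<Rightarrow> nat list \<Rightarrow> 'a \<Rightarrow> 'a" where
  "ifs_Phi f [] = id"
| "ifs_Phi f (i # I) = ifs_Phi f I \<circ> f i"

definition hutchinson :: "nat \<Rightarrow> (nat \<Rightarrow> 'a \<Rightarrow> 'a) \<Rightarrow> 'a set \<Rightarrow> 'a set" where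
  "hutchinson m f A = (\<Union>i\<in>{1..m}. f i ` A)"

definition forward_invariant :: "nat \<Rightarrow> (nat \<Rightarrow> 'a \<Rightarrow> 'a) \<Rightarrow> 'a set \<Rightarrow> bool" where
  "forward_invariant m f A \<longleftrightarrow> (\<forall>i\<in>{1..m}. f i ` A \<subseteq> A)"

definition H_invariant :: "nat \<Rightarrow> (nat \<Rightarrow> 'a \<Rightarrow> 'a) \<Rightarrow> 'a set \<Rightarrow> bool" where
  "H_invariant m f A \<longleftrightarrow> hutchinson m f A = A"

definition ifs_orbit :: "nat \<Rightarrow> (nat \<Rightarrow> 'a \<Rightarrow> 'a) \<Rightarrow> 'a \<Rightarrow> 'a set" where
  "ifs_orbit m f x = {ifs_Phi f I x |I. I \<in> ifs_words m}"

definition ifs_Omega ::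
    "nat \<Rightarrow> (nat \<Rightarrow> 'a::topological_space \<Rightarrow> 'a) \<Rightarrow> 'a set \<Rightarrow> 'a set" where
  "ifs_Omega m f A = {y. \<exists>I a. (\<forall>n::nat. I n \<in> ifs_words m \<and> a n \<in> A) \<and>
      filterlim (\<lambda>n. length (I n)) at_top sequentially \<and>
      (\<lambda>n. ifs_Phi f (I n) (a n)) \<longlonglongrightarrow> y}"

text \<open>The neighbourhood \<open>{x. d(x, A) < \<epsilon>}\<close>. It is not written with \<^const>\<open>infdist\<close> because
  \<open>infdist x {} = 0\<close>, which would make the empty set attract everything; here the
  neighbourhood of the empty set is empty.\<close>

definition eps_nbhd :: "real \<Rightarrow> 'a::metric_space set \<Rightarrow> 'a set" where
  "eps_nbhd \<epsilon> A = {x. \<exists>a\<in>A. dist x a < \<epsilon>}"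

definition attracts :: "nat \<Rightarrow> (nat \<Rightarrow> 'a::metric_space \<Rightarrow> 'a) \<Rightarrow> 'a set \<Rightarrow> 'a set \<Rightarrow> bool" where
  "attracts m f A K \<longleftrightarrow> (\<forall>\<epsilon>>0. \<exists>\<tau>>0. \<forall>I\<in>ifs_words m.
      \<tau> \<le> length I \<longrightarrow> ifs_Phi f I ` K \<subseteq> eps_nbhd \<epsilon> A)"

definition global_attractor :: "nat \<Rightarrow> (nat \<Rightarrow> 'a::metric_space \<Rightarrow> 'a) \<Rightarrow> 'a set \<Rightarrow> bool" where
  "global_attractor m f A \<longleftrightarrow>
     compact A \<and> H_invariant m f A \<and> (\<forall>K. compact K \<longrightarrow> attracts m f A K)"

definition compact_dynamics :: "nat \<Rightarrow> (nat \<Rightarrow> 'a::metric_space \<Rightarrow> 'a) \<Rightarrow> bool" where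
  "compact_dynamics m f \<longleftrightarrow> (\<exists>A. global_attractor m f A)"

text \<open>Chains of length \<open>k = 0\<close> are allowed. Only the values \<open>x 0, ..., x k\<close> and
  \<open>i 0, ..., i (k - 1)\<close> of the two sequences matter.\<close>

definition eps_chain ::
    "nat \<Rightarrow> (nat \<Rightarrow> 'a::metric_space \<Rightarrow> 'a) \<Rightarrow> real \<Rightarrow> 'a \<Rightarrow> 'a \<Rightarrow> bool" where
  "eps_chain m f \<epsilon> a b \<longleftrightarrow> (\<exists>(k::nat) (x::nat \<Rightarrow> 'a) (i::nat \<Rightarrow> nat).
      x 0 = a \<and> x k = b \<and>
      (\<forall>n<k. i n \<in> {1..m} \<and> dist (f (i n) (x n)) (x (Suc n)) < \<epsilon>))"

definition chain_above :: "nat \<Rightarrow> (nat \<Rightarrow> 'a::metric_space \<Rightarrow> 'a) \<Rightarrow> 'a \<Rightarrow> 'a \<Rightarrow> bool" where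
  "chain_above m f x y \<longleftrightarrow> (\<forall>\<epsilon>>0. eps_chain m f \<epsilon> x y)"

definition chain_equivalent ::
    "nat \<Rightarrow> (nat \<Rightarrow> 'a::metric_space \<Rightarrow> 'a) \<Rightarrow> 'a \<Rightarrow> 'a \<Rightarrow> bool" where
  "chain_equivalent m f x y \<longleftrightarrow> chain_above m f x y \<and> chain_above m f y x"

definition orbitwise_chain_recurrent ::
    "nat \<Rightarrow> (nat \<Rightarrow> 'a::metric_space \<Rightarrow> 'a) \<Rightarrow> 'a set" where
  "orbitwise_chain_recurrent m f = {x. \<forall>y\<in>ifs_orbit m f x. chain_equivalent m f x y}"

definition orbitwise_chain_nodes ::
    "nat \<Rightarrow> (nat \<Rightarrow> 'a::metric_space \<Rightarrow> 'a) \<Rightarrow> 'a set set" where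
  "orbitwise_chain_nodes m f = orbitwise_chain_recurrent m f //
     {(x, y). x \<in> orbitwise_chain_recurrent m f \<and> y \<in> orbitwise_chain_recurrent m f \<and>
              chain_equivalent m f x y}"

end

theory Submission
  imports Defs
begin

text \<open>Arbitrarily long chains lead from a chain-recurrent point back to itself, while long chains
  are forced towards the global attractor; so a node \<open>N\<close> lies in the compact attractor. Moreover
  \<open>N\<close> is the set of points whose whole orbit is chain-equivalent to one fixed \<open>x \<in> N\<close>, from which
  it is forward-invariant and closed, hence compact. The claims on \<open>\<Omega>(N)\<close> then follow by
  compactness and forward-invariance alone.\<close>

subsection \<open>Words\<close>

lemma ifs_Phi_append: "ifs_Phi f (I @ J) = ifs_Phi f J \<circ> ifs_Phi f I"
  by (induction I) (auto simp: o_assoc)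

lemma Nil_in_ifs_words [simp]: "[] \<in> ifs_words m"
  by (simp add: ifs_words_def)

lemma Cons_in_ifs_words [simp]: "i # I \<in> ifs_words m \<longleftrightarrow> i \<in> {1..m} \<and> I \<in> ifs_words m"
  by (auto simp: ifs_words_def)

lemma append_in_ifs_words [simp]:
  "I @ J \<in> ifs_words m \<longleftrightarrow> I \<in> ifs_words m \<and> J \<in> ifs_words m"
  by (auto simp: ifs_words_def)

lemma continuous_on_ifs_Phi:
  assumes "ifs m f" and "I \<in> ifs_words m"
  shows "continuous_on UNIV (ifs_Phi f I)"
  using assms(2)
proof (induction I)
  case Nil
  then show ?case by (simp add: id_def)
next
  case (Cons i I)
  then show ?case
    using assms(1) unfolding ifs_Phi.simps
    by (intro continuous_on_compose) (auto simp: ifs_def intro: continuous_on_subset)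
qed

lemma forward_invariant_ifs_Phi:
  assumes "forward_invariant m f A" and "I \<in> ifs_words m" and "a \<in> A"
  shows "ifs_Phi f I a \<in> A"
  using assms(2,3)
proof (induction I arbitrary: a)
  case (Cons i I)
  then have "f i a \<in> A"
    using assms(1) unfolding forward_invariant_def Cons_in_ifs_words by blast
  with Cons show ?case by simp
qed simp

lemma compact_hutchinson:
  fixes f :: "nat \<Rightarrow> 'a::topological_space \<Rightarrow> 'a"
  assumes "ifs m f" and "compact K"
  shows "compact (hutchinson m f K)"
  unfolding hutchinson_def
proof (intro compact_UN)
  fix i assume "i \<in> {1..m}"
  then have "continuous_on K (f i)"
    using assms(1) unfolding ifs_def by (meson continuous_on_subset subset_UNIV)
  then show "compact (f i ` K)"
    using assms(2) by (rule compact_continuous_image)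
qed simp

lemma compact_hutchinson_power:
  fixes f :: "nat \<Rightarrow> 'a::topological_space \<Rightarrow> 'a"
  assumes "ifs m f" and "compact K"
  shows "compact ((hutchinson m f ^^ n) K)"
  using assms by (induction n) (simp_all add: compact_hutchinson)

text \<open>Bridge between two views of iteration: powers of \<open>hutchinson m f\<close> preserve
  compactness and suit induction, while words are what attraction and \<open>ifs_Omega\<close> speak
  of. The induction splits off the last letter, because the outermost map is the one applied
  last.\<close>

lemma hutchinson_power_eq:
  "(hutchinson m f ^^ n) K = {ifs_Phi f I a | I a. I \<in> ifs_words m \<and> length I = n \<and> a \<in> K}"
proof (induction n)
  case 0
  then show ?case by auto
next
  case (Suc n)
  show ?case
  proof (intro equalityI subsetI)
    fix y assume "y \<in> (hutchinson m f ^^ Suc n) K"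
    then obtain i I a where "i \<in> {1..m}" "I \<in> ifs_words m" "length I = n" "a \<in> K"
      "y = f i (ifs_Phi f I a)"
      by (auto simp: Suc hutchinson_def)
    then have "I @ [i] \<in> ifs_words m" "length (I @ [i]) = Suc n" "y = ifs_Phi f (I @ [i]) a"
      by (simp_all add: ifs_Phi_append)
    with \<open>a \<in> K\<close>
    show "y \<in> {ifs_Phi f I a | I a. I \<in> ifs_words m \<and> length I = Suc n \<and> a \<in> K}"
      by blast
  next
    fix y assume "y \<in> {ifs_Phi f I a | I a. I \<in> ifs_words m \<and> length I = Suc n \<and> a \<in> K}"
    then obtain I a where "I \<in> ifs_words m" "length I = Suc n" "a \<in> K" "y = ifs_Phi f I a"
      by blast
    moreover from this obtain J i where "I = J @ [i]" "length J = n"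
      unfolding length_Suc_conv_rev by blast
    ultimately have "i \<in> {1..m}" "ifs_Phi f J a \<in> (hutchinson m f ^^ n) K"
      "y = f i (ifs_Phi f J a)"
      by (auto simp: Suc ifs_Phi_append)
    then show "y \<in> (hutchinson m f ^^ Suc n) K"
      unfolding funpow.simps comp_apply hutchinson_def[of m f "_ K"] by blast
  qed
qed

subsection \<open>Chains\<close>

text \<open>One link of a chain as a relation, so that chains become its reflexive transitive
  closure and chains of a fixed length its powers.\<close>

definition chain_step ::
    "nat \<Rightarrow> (nat \<Rightarrow> 'a::metric_space \<Rightarrow> 'a) \<Rightarrow> real \<Rightarrow> 'a \<Rightarrow> 'a \<Rightarrow> bool" where
  "chain_step m f \<epsilon> a b \<longleftrightarrow> (\<exists>i\<in>{1..m}. dist (f i a) b < \<epsilon>)"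

lemma eps_chain_iff_rtranclp: "eps_chain m f \<epsilon> a b \<longleftrightarrow> (chain_step m f \<epsilon>)\<^sup>*\<^sup>* a b"
proof
  assume "eps_chain m f \<epsilon> a b"
  then obtain k x i where x: "x 0 = a" "x k = b"
    "\<forall>n<k. i n \<in> {1..m} \<and> dist (f (i n) (x n)) (x (Suc n)) < \<epsilon>"
    unfolding eps_chain_def by blast
  then have "\<forall>n<k. chain_step m f \<epsilon> (x n) (x (Suc n))"
    unfolding chain_step_def by blast
  with x(1,2) show "(chain_step m f \<epsilon>)\<^sup>*\<^sup>* a b"
    unfolding rtranclp_power relpowp_fun_conv by blast
next
  assume "(chain_step m f \<epsilon>)\<^sup>*\<^sup>* a b"
  then obtain k x where x: "x 0 = a" "x k = b" "\<forall>n<k. chain_step m f \<epsilon> (x n) (x (Suc n))"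
    unfolding rtranclp_power relpowp_fun_conv by blast
  then have "\<forall>n. \<exists>i. n < k \<longrightarrow> i \<in> {1..m} \<and> dist (f i (x n)) (x (Suc n)) < \<epsilon>"
    unfolding chain_step_def by blast
  then obtain i where "\<forall>n. n < k \<longrightarrow> i n \<in> {1..m} \<and> dist (f (i n) (x n)) (x (Suc n)) < \<epsilon>"
    by metis
  with x(1,2) show "eps_chain m f \<epsilon> a b"
    unfolding eps_chain_def by blast
qed

lemma chain_above_iff: "chain_above m f x y \<longleftrightarrow> (\<forall>\<epsilon>>0. (chain_step m f \<epsilon>)\<^sup>*\<^sup>* x y)"
  by (simp add: chain_above_def eps_chain_iff_rtranclp)

lemma chain_above_trans: "chain_above m f x y \<Longrightarrow> chain_above m f y z \<Longrightarrow> chain_above m f x z"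
  unfolding chain_above_iff by (meson rtranclp_trans)

lemma chain_equivalent_sym: "chain_equivalent m f x y \<Longrightarrow> chain_equivalent m f y x"
  by (simp add: chain_equivalent_def)

lemma chain_equivalent_trans:
  "chain_equivalent m f x y \<Longrightarrow> chain_equivalent m f y z \<Longrightarrow> chain_equivalent m f x z"
  unfolding chain_equivalent_def by (meson chain_above_trans)

section \<open>Orbitwise chain nodes: description by one base point, invariance, closedness\<close>

lemma orbitwise_chain_recurrent_iff:
  "x \<in> orbitwise_chain_recurrent m f \<longleftrightarrow>
    (\<forall>I\<in>ifs_words m. chain_equivalent m f x (ifs_Phi f I x))"
  by (auto simp: orbitwise_chain_recurrent_def ifs_orbit_def)

text \<open>Since chains of length 0 count, \<open>chain_above m f x x\<close> holds trivially and
  yields no loop. Going through \<open>f 1 x\<close> forces at least one step.\<close>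

lemma chain_above_tranclp:
  assumes "1 \<le> m" and "chain_above m f (f 1 x) y" and "0 < \<epsilon>"
  shows "(chain_step m f \<epsilon>)\<^sup>+\<^sup>+ x y"
proof -
  have "chain_step m f \<epsilon> x (f 1 x)"
    unfolding chain_step_def using assms(1,3) by (intro bexI[of _ 1]) auto
  then show ?thesis
    using assms(2,3) unfolding chain_above_iff by (meson rtranclp_into_tranclp2)
qed

text \<open>Recurrence need not be demanded of \<open>y\<close> separately: if its whole orbit,
  \<open>y\<close> included, is equivalent to \<open>x\<close>, then \<open>y\<close> is equivalent
  to its orbit by transitivity. The resulting condition is stable under the maps and under
  limits.\<close>

lemma orbitwise_chain_nodeE:
  assumes "N \<in> orbitwise_chain_nodes m f"
  obtains x where "x \<in> N" and
    "N = {y. \<forall>I\<in>ifs_words m. chain_equivalent m f x (ifs_Phi f I y)}"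
proof -
  from assms obtain x where x: "x \<in> orbitwise_chain_recurrent m f"
    and N: "N = {y \<in> orbitwise_chain_recurrent m f. chain_equivalent m f x y}"
    unfolding orbitwise_chain_nodes_def by (auto elim!: quotientE)
  have "chain_equivalent m f x (ifs_Phi f [] x)"
    using x unfolding orbitwise_chain_recurrent_iff by (simp del: ifs_Phi.simps)
  then have "x \<in> N"
    using x by (simp add: N)
  moreover have "y \<in> N" if y: "\<forall>I\<in>ifs_words m. chain_equivalent m f x (ifs_Phi f I y)" for y
  proof -
    have "chain_equivalent m f x (ifs_Phi f [] y)"
      using y by (simp del: ifs_Phi.simps)
    then have "chain_equivalent m f x y" by simp
    then show ?thesis
      unfolding N orbitwise_chain_recurrent_iff mem_Collect_eq
      using y by (meson chain_equivalent_sym chain_equivalent_trans)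
  qed
  moreover have "chain_equivalent m f x (ifs_Phi f I y)" if "y \<in> N" "I \<in> ifs_words m" for y I
    using that unfolding N orbitwise_chain_recurrent_iff mem_Collect_eq
    by (meson chain_equivalent_trans)
  ultimately show ?thesis
    by (intro that[of x]) blast+
qed

lemma forward_invariant_orbitwise_chain_node:
  assumes "N \<in> orbitwise_chain_nodes m f"
  shows "forward_invariant m f N"
proof -
  obtain x where N: "N = {y. \<forall>I\<in>ifs_words m. chain_equivalent m f x (ifs_Phi f I y)}"
    using orbitwise_chain_nodeE[OF assms] by metis
  have "f i y \<in> N" if "y \<in> N" "i \<in> {1..m}" for i y
    unfolding N mem_Collect_eq
  proof
    fix I assume "I \<in> ifs_words m"
    \<comment> \<open>The orbit of \<open>f i y\<close> is reached from \<open>y\<close> by the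
      words that begin with \<open>i\<close>.\<close>
    then have "chain_equivalent m f x (ifs_Phi f (i # I) y)"
      using that unfolding N by (simp del: ifs_Phi.simps)
    then show "chain_equivalent m f x (ifs_Phi f I (f i y))" by simp
  qed
  then show ?thesis by (auto simp: forward_invariant_def)
qed

text \<open>Towards \<open>z\<close>, the last jump of a chain from \<open>x\<close> to a nearby
  \<open>c n\<close> is redirected to \<open>z\<close>. Away from \<open>z\<close>, continuity makes
  \<open>f 1 (c n)\<close> a legitimate first jump, and \<open>fc\<close> leads from there to
  \<open>x\<close>.\<close>

lemma chain_equivalent_limit:
  fixes f :: "nat \<Rightarrow> 'a::metric_space \<Rightarrow> 'a"
  assumes "ifs m f" and "chain_above m f (f 1 x) x"
    and c: "\<And>n::nat. chain_equivalent m f x (c n)"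
    and fc: "\<And>n. chain_equivalent m f x (f 1 (c n))"
    and lim: "c \<longlonglongrightarrow> z"
  shows "chain_equivalent m f x z"
proof -
  have m: "1 \<le> m" and cont: "continuous_on UNIV (f 1)"
    using assms(1) by (auto simp: ifs_def)
  have lim1: "(\<lambda>n. f 1 (c n)) \<longlonglongrightarrow> f 1 z"
    using continuous_on_tendsto_compose[OF cont lim] by simp
  have "(chain_step m f \<epsilon>)\<^sup>*\<^sup>* x z" if "\<epsilon> > 0" for \<epsilon>
  proof -
    obtain n where n: "dist (c n) z < \<epsilon> / 2"
      using metric_LIMSEQ_D[OF lim, of "\<epsilon> / 2"] \<open>\<epsilon> > 0\<close> by auto
    \<comment> \<open>This ensures a chain from \<open>x\<close> to \<open>c n\<close> with a last
      jump to redirect, even when \<open>c n = x\<close>.\<close>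
    have "chain_above m f (f 1 x) (c n)"
      using assms(2) c chain_above_trans unfolding chain_equivalent_def by blast
    then have "(chain_step m f (\<epsilon> / 2))\<^sup>+\<^sup>+ x (c n)"
      using \<open>\<epsilon> > 0\<close> by (intro chain_above_tranclp[OF m]) simp_all
    then obtain w where w: "(chain_step m f (\<epsilon> / 2))\<^sup>*\<^sup>* x w" "chain_step m f (\<epsilon> / 2) w (c n)"
      using tranclD2[to_pred] by metis
    have "chain_step m f \<epsilon> u v" if "chain_step m f (\<epsilon> / 2) u v" for u v
      using that \<open>\<epsilon> > 0\<close> by (force simp: chain_step_def)
    then have "(chain_step m f \<epsilon>)\<^sup>*\<^sup>* x w"
      using w(1) rtranclp_mono[of "chain_step m f (\<epsilon> / 2)" "chain_step m f \<epsilon>"] by blast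
    moreover obtain i where i: "i \<in> {1..m}" "dist (f i w) (c n) < \<epsilon> / 2"
      using w(2) by (auto simp: chain_step_def)
    then have "dist (f i w) z < \<epsilon>"
      using n dist_triangle_half_r[of "c n" "f i w" \<epsilon> z] by (simp add: dist_commute)
    with i(1) have "chain_step m f \<epsilon> w z"
      by (auto simp: chain_step_def)
    ultimately show ?thesis by simp
  qed
  moreover have "(chain_step m f \<epsilon>)\<^sup>*\<^sup>* z x" if "\<epsilon> > 0" for \<epsilon>
  proof -
    obtain n where "dist (f 1 (c n)) (f 1 z) < \<epsilon>"
      using metric_LIMSEQ_D[OF lim1 \<open>\<epsilon> > 0\<close>] by auto
    then have "chain_step m f \<epsilon> z (f 1 (c n))"
      unfolding chain_step_def using m by (intro bexI[of _ 1]) (auto simp: dist_commute)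
    moreover have "(chain_step m f \<epsilon>)\<^sup>*\<^sup>* (f 1 (c n)) x"
      using fc[of n] that by (simp add: chain_equivalent_def chain_above_iff)
    ultimately show ?thesis by (rule converse_rtranclp_into_rtranclp)
  qed
  ultimately show ?thesis
    by (simp add: chain_equivalent_def chain_above_iff)
qed

lemma closed_orbitwise_chain_node:
  fixes f :: "nat \<Rightarrow> 'a::metric_space \<Rightarrow> 'a"
  assumes "ifs m f" and "N \<in> orbitwise_chain_nodes m f"
  shows "closed N"
proof -
  obtain x where "x \<in> N"
    and N: "N = {y. \<forall>I\<in>ifs_words m. chain_equivalent m f x (ifs_Phi f I y)}"
    using orbitwise_chain_nodeE[OF assms(2)] by metis
  have m: "1 \<le> m" using assms(1) by (simp add: ifs_def)
  have "chain_equivalent m f x (ifs_Phi f [1] x)"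
    using \<open>x \<in> N\<close> m unfolding N by (simp del: ifs_Phi.simps)
  then have x: "chain_above m f (f 1 x) x"
    by (simp add: chain_equivalent_def)
  have "y \<in> N" if b: "\<And>n. b n \<in> N" and lim: "b \<longlonglongrightarrow> y" for b y
    unfolding N mem_Collect_eq
  proof
    fix I assume I: "I \<in> ifs_words m"
    \<comment> \<open>The longer word supplies the images under \<open>f 1\<close> that the limit
      lemma needs for the way back to \<open>x\<close>.\<close>
    have "chain_equivalent m f x (ifs_Phi f (I @ [1]) (b n))" for n
      using b[of n] m I unfolding N by (simp del: ifs_Phi.simps)
    then have fc: "chain_equivalent m f x (f 1 (ifs_Phi f I (b n)))" for n
      by (simp add: ifs_Phi_append)
    have c: "chain_equivalent m f x (ifs_Phi f I (b n))" for n
      using b[of n] I unfolding N by blast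
    have "(\<lambda>n. ifs_Phi f I (b n)) \<longlonglongrightarrow> ifs_Phi f I y"
      using continuous_on_tendsto_compose[OF continuous_on_ifs_Phi[OF assms(1) I] lim] by simp
    then show "chain_equivalent m f x (ifs_Phi f I y)"
      by (rule chain_equivalent_limit[OF assms(1) x c fc])
  qed
  then show ?thesis by (auto simp: closed_sequential_limits)
qed

subsection \<open>Attraction of chains\<close>

text \<open>For a fixed number of steps, sufficiently fine chains follow true orbits closely,
  uniformly over the compact starting set. The induction removes the last step and pulls the target
  \<open>U\<close> back through all the maps, hence the arbitrary \<open>U\<close>.\<close>

lemma chain_power_subset_open:
  fixes f :: "nat \<Rightarrow> 'a::metric_space \<Rightarrow> 'a"
  assumes "ifs m f" and "compact K" and "open U" and "(hutchinson m f ^^ n) K \<subseteq> U"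
  obtains \<delta> where "\<delta> > 0" and "\<And>a b. a \<in> K \<Longrightarrow> (chain_step m f \<delta> ^^ n) a b \<Longrightarrow> b \<in> U"
proof -
  have "\<exists>\<delta>>0. \<forall>a\<in>K. \<forall>b. (chain_step m f \<delta> ^^ n) a b \<longrightarrow> b \<in> U"
    using assms(3,4)
  proof (induction n arbitrary: U)
    case 0
    then show ?case by (auto intro: exI[of _ 1])
  next
    case (Suc n)
    obtain e where e: "e > 0" "(\<Union>c\<in>(hutchinson m f ^^ Suc n) K. ball c e) \<subseteq> U"
      using compact_subset_open_imp_ball_epsilon_subset
        [OF compact_hutchinson_power[OF assms(1,2), of "Suc n"] Suc.prems(1,2)]
      by metis
    \<comment> \<open>Half of the radius \<open>e\<close> is kept in reserve for the error of the
      last jump. The set \<open>V\<close> below collects the points that every map sends into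
      \<open>W\<close>.\<close>
    define W where "W = (\<Union>c\<in>(hutchinson m f ^^ Suc n) K. ball c (e / 2))"
    define V where "V = (\<Inter>i\<in>{1..m}. f i -` W)"
    have "open W" by (auto simp: W_def)
    then have "open (f i -` W)" if "i \<in> {1..m}" for i
      using assms(1) that by (auto simp: ifs_def intro: open_vimage)
    then have "open V"
      unfolding V_def by (intro open_INT) auto
    moreover have "(hutchinson m f ^^ n) K \<subseteq> V"
    proof
      fix c assume c: "c \<in> (hutchinson m f ^^ n) K"
      have "f i c \<in> W" if "i \<in> {1..m}" for i
      proof -
        have "f i c \<in> (hutchinson m f ^^ Suc n) K"
          using c that by (auto simp: hutchinson_def)
        then show ?thesis
          using e(1) unfolding W_def by (meson UN_I centre_in_ball half_gt_zero)
      qed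
      then show "c \<in> V" by (simp add: V_def)
    qed
    ultimately obtain d where d: "d > 0" "\<forall>a\<in>K. \<forall>b. (chain_step m f d ^^ n) a b \<longrightarrow> b \<in> V"
      using Suc.IH by blast
    define \<delta> where "\<delta> = min d (e / 2)"
    have mono: "chain_step m f \<delta> u v \<Longrightarrow> chain_step m f d u v" for u v
      by (force simp: chain_step_def \<delta>_def)
    have "b \<in> U" if "a \<in> K" and ab: "(chain_step m f \<delta> ^^ Suc n) a b" for a b
    proof -
      obtain c where c: "(chain_step m f \<delta> ^^ n) a c" "chain_step m f \<delta> c b"
        using ab by auto
      have "(chain_step m f d ^^ n) a c"
        using c(1) mono unfolding relpowp_fun_conv by blast
      then have "c \<in> V" using d(2) \<open>a \<in> K\<close> by blast
      obtain i where i: "i \<in> {1..m}" "dist (f i c) b < e / 2"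
        using c(2) by (auto simp: chain_step_def \<delta>_def)
      then have "f i c \<in> W" using \<open>c \<in> V\<close> by (auto simp: V_def)
      then obtain w where w: "w \<in> (hutchinson m f ^^ Suc n) K" "dist w (f i c) < e / 2"
        by (auto simp: W_def)
      then have "dist w b < e"
        using i(2) by (metis dist_commute dist_triangle_half_r)
      with w(1) e(2) show ?thesis by (meson UN_I mem_ball subsetD)
    qed
    moreover have "\<delta> > 0" using d(1) e(1) by (simp add: \<delta>_def)
    ultimately show ?case by blast
  qed
  then show ?thesis using that by blast
qed

text \<open>Local compactness enters here: finitely many open sets with compact supersets cover
  \<open>A\<close>, and by compactness they cover a uniform neighbourhood of it.\<close>

lemma compact_eps_nbhd:
  fixes A :: "'a::metric_space set"
  assumes "locally_compact_space (euclidean :: 'a topology)" and "compact A"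
  obtains e K where "e > 0" and "compact K" and "eps_nbhd e A \<subseteq> K"
proof -
  have "\<forall>x::'a. \<exists>U K. open U \<and> compact K \<and> x \<in> U \<and> U \<subseteq> K"
    using assms(1) by (simp add: locally_compact_space_def)
  then obtain U K where UK: "\<And>x::'a. open (U x) \<and> compact (K x) \<and> x \<in> U x \<and> U x \<subseteq> K x"
    by metis
  obtain F where F: "finite F" "A \<subseteq> (\<Union>x\<in>F. U x)"
    using compactE_image[OF assms(2), of A U] UK by (metis UN_I subsetI)
  have "open (\<Union>x\<in>F. U x)" using UK by blast
  then obtain e where "e > 0" "(\<Union>x\<in>A. ball x e) \<subseteq> (\<Union>x\<in>F. U x)"
    using compact_subset_open_imp_ball_epsilon_subset[OF assms(2) _ F(2)] by metis
  moreover have "eps_nbhd e A \<subseteq> (\<Union>x\<in>A. ball x e)"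
    by (auto simp: eps_nbhd_def dist_commute)
  moreover have "(\<Union>x\<in>F. U x) \<subseteq> (\<Union>x\<in>F. K x)" using UK by blast
  moreover have "compact (\<Union>x\<in>F. K x)" using F(1) UK by blast
  ultimately show ?thesis using that by (meson order_trans)
qed

lemma open_eps_nbhd: "open (eps_nbhd e A)"
proof -
  have "eps_nbhd e A = (\<Union>a\<in>A. ball a e)"
    by (auto simp: eps_nbhd_def dist_commute)
  then show ?thesis by auto
qed

lemma eps_nbhd_mono: "e \<le> e' \<Longrightarrow> eps_nbhd e A \<subseteq> eps_nbhd e' A"
  by (force simp: eps_nbhd_def)

text \<open>Chains of \<open>\<tau>\<close> steps from a compact neighbourhood of \<open>A\<close>
  end close to \<open>A\<close>, hence again in that neighbourhood, so blocks of
  \<open>\<tau>\<close> steps can be concatenated. A loop at \<open>x\<close>, repeated until its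
  length is a multiple of \<open>\<tau>\<close>, shows that \<open>x\<close> itself is close to
  \<open>A\<close>.\<close>

lemma chain_loop_in_global_attractor:
  fixes f :: "nat \<Rightarrow> 'a::metric_space \<Rightarrow> 'a"
  assumes "locally_compact_space (euclidean :: 'a topology)" and "ifs m f"
    and A: "global_attractor m f A"
    and loop: "\<And>\<delta>. \<delta> > 0 \<Longrightarrow> (chain_step m f \<delta>)\<^sup>+\<^sup>+ x x"
  shows "x \<in> A"
proof -
  have "compact A" using A by (simp add: global_attractor_def)
  obtain e K where e: "e > 0" and "compact K" and K: "eps_nbhd e A \<subseteq> K"
    using compact_eps_nbhd[OF assms(1) \<open>compact A\<close>] by metis
  \<comment> \<open>The first block starts at \<open>x\<close>, which is not yet known to lie in
    \<open>K\<close>.\<close>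
  have K': "compact (insert x K)" using \<open>compact K\<close> by simp
  have "x \<in> eps_nbhd \<epsilon> A" if "\<epsilon> > 0" for \<epsilon>
  proof -
    \<comment> \<open>The bound \<open>r \<le> e\<close> keeps the end of each block in
      \<open>K\<close>, from where the next block may start.\<close>
    define r where "r = min \<epsilon> e"
    have "r > 0" using that e by (simp add: r_def)
    have "attracts m f A (insert x K)"
      using A K' unfolding global_attractor_def by blast
    then obtain \<tau> where "\<tau> > 0" and \<tau>: "\<forall>I\<in>ifs_words m. \<tau> \<le> length I \<longrightarrow>
        ifs_Phi f I ` insert x K \<subseteq> eps_nbhd r A"
      using \<open>r > 0\<close> unfolding attracts_def by meson
    have "(hutchinson m f ^^ \<tau>) (insert x K) \<subseteq> eps_nbhd r A"
      unfolding hutchinson_power_eq using \<tau> by blast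
    then obtain \<delta> where "\<delta> > 0"
      and \<delta>: "\<And>a b. a \<in> insert x K \<Longrightarrow> (chain_step m f \<delta> ^^ \<tau>) a b \<Longrightarrow> b \<in> eps_nbhd r A"
      using chain_power_subset_open[OF assms(2) K' open_eps_nbhd] by metis
    have sub: "eps_nbhd r A \<subseteq> insert x K"
      using K eps_nbhd_mono[of r e A] by (auto simp: r_def)
    \<comment> \<open>At least one block is required, since the starting point \<open>x\<close> need
      not be near \<open>A\<close> a priori.\<close>
    have inv: "b \<in> eps_nbhd r A" if "(chain_step m f \<delta> ^^ (Suc j * \<tau>)) x b" for j b
      using that
    proof (induction j arbitrary: b)
      case 0
      then show ?case using \<delta>[of x b] by simp
    next
      case (Suc j)
      have "Suc (Suc j) * \<tau> = Suc j * \<tau> + \<tau>" by simp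
      then obtain c where "(chain_step m f \<delta> ^^ (Suc j * \<tau>)) x c" "(chain_step m f \<delta> ^^ \<tau>) c b"
        using Suc.prems by (metis relpowp_add relcompp_apply)
      then show ?case using Suc.IH \<delta> sub by blast
    qed
    obtain l where "l > 0" and l: "(chain_step m f \<delta> ^^ l) x x"
      using loop[OF \<open>\<delta> > 0\<close>] unfolding tranclp_power by blast
    have "(chain_step m f \<delta> ^^ (l * j)) x x" for j
    proof (induction j)
      case (Suc j)
      then show ?case using l by (auto simp: relpowp_add)
    qed simp
    \<comment> \<open>Running the loop of length \<open>l\<close> exactly \<open>\<tau>\<close>
      times gives \<open>l\<close> blocks of \<open>\<tau>\<close> steps, that is,
      \<open>Suc (l - 1)\<close> blocks.\<close>
    then have "x \<in> eps_nbhd r A"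
      using inv[of "l - 1"] \<open>l > 0\<close> by simp
    then show ?thesis
      using eps_nbhd_mono[of r \<epsilon> A] by (auto simp: r_def)
  qed
  then have "\<forall>\<epsilon>>0. \<exists>a\<in>A. dist a x < \<epsilon>"
    by (auto simp: eps_nbhd_def dist_commute)
  then have "x \<in> closure A"
    by (simp add: closure_approachable)
  then show ?thesis
    using \<open>compact A\<close> by (simp add: compact_imp_closed)
qed

lemma compact_orbitwise_chain_node:
  fixes f :: "nat \<Rightarrow> 'a::metric_space \<Rightarrow> 'a"
  assumes "locally_compact_space (euclidean :: 'a topology)" and "ifs m f"
    and "compact_dynamics m f" and "N \<in> orbitwise_chain_nodes m f"
  shows "compact N"
proof -
  obtain A where A: "global_attractor m f A"
    using assms(3) by (auto simp: compact_dynamics_def)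
  have m: "1 \<le> m" using assms(2) by (simp add: ifs_def)
  obtain x where N: "N = {y. \<forall>I\<in>ifs_words m. chain_equivalent m f x (ifs_Phi f I y)}"
    using orbitwise_chain_nodeE[OF assms(4)] by metis
  have "y \<in> A" if "y \<in> N" for y
  proof (rule chain_loop_in_global_attractor[OF assms(1,2) A])
    \<comment> \<open>Both \<open>y\<close> and \<open>f 1 y\<close> are equivalent to the base
      point, so \<open>f 1 y\<close> leads back to \<open>y\<close>, which closes loops of positive
      length at \<open>y\<close>.\<close>
    have "chain_equivalent m f x (ifs_Phi f [] y)" "chain_equivalent m f x (ifs_Phi f [1] y)"
      using that m unfolding N by (simp_all del: ifs_Phi.simps)
    then have "chain_above m f (f 1 y) y"
      by (auto simp: chain_equivalent_def intro: chain_above_trans)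
    then show "(chain_step m f \<delta>)\<^sup>+\<^sup>+ y y" if "\<delta> > 0" for \<delta>
      using chain_above_tranclp[OF m] that by blast
  qed
  then have "A \<inter> N = N" by blast
  moreover have "compact (A \<inter> N)"
    using A closed_orbitwise_chain_node[OF assms(2,4)]
    by (auto simp: global_attractor_def intro: compact_Int_closed)
  ultimately show ?thesis by simp
qed

subsection \<open>Omega-limit sets of compact forward-invariant sets\<close>

lemma ifs_OmegaI:
  assumes "\<And>n::nat. I n \<in> ifs_words m" and "\<And>n. a n \<in> A"
    and "filterlim (\<lambda>n. length (I n)) at_top sequentially"
    and "(\<lambda>n. ifs_Phi f (I n) (a n)) \<longlonglongrightarrow> y"
  shows "y \<in> ifs_Omega m f A"
  using assms unfolding ifs_Omega_def by blast

text \<open>The limit set as an intersection of closures of tails, from which it is visibly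
  closed.\<close>

lemma ifs_Omega_eq:
  fixes f :: "nat \<Rightarrow> 'a::metric_space \<Rightarrow> 'a"
  shows "ifs_Omega m f A =
    (\<Inter>n. closure {ifs_Phi f I a | I a. I \<in> ifs_words m \<and> n \<le> length I \<and> a \<in> A})"
    (is "_ = (\<Inter>n. closure (?S n))")
proof (intro equalityI subsetI INT_I)
  fix y n
  assume "y \<in> ifs_Omega m f A"
  then obtain I a where Ia: "\<forall>n::nat. I n \<in> ifs_words m \<and> a n \<in> A"
    and len: "filterlim (\<lambda>n. length (I n)) at_top sequentially"
    and lim: "(\<lambda>n. ifs_Phi f (I n) (a n)) \<longlonglongrightarrow> y"
    unfolding ifs_Omega_def by blast
  have "\<forall>\<^sub>F k in sequentially. n \<le> length (I k)"
    using len by (simp add: filterlim_at_top)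
  then have "\<forall>\<^sub>F k in sequentially. ifs_Phi f (I k) (a k) \<in> closure (?S n)"
  proof eventually_elim
    case (elim k)
    then have "ifs_Phi f (I k) (a k) \<in> ?S n"
      using Ia by blast
    then show ?case
      by (rule subsetD[OF closure_subset])
  qed
  then show "y \<in> closure (?S n)"
    by (rule Lim_in_closed_set[OF closed_closure _ sequentially_bot lim])
next
  fix y
  assume y: "y \<in> (\<Inter>n. closure (?S n))"
  \<comment> \<open>A diagonal choice: the same index \<open>n\<close> controls the length of the
    word and the distance to \<open>y\<close>.\<close>
  have "\<exists>I a. I \<in> ifs_words m \<and> n \<le> length I \<and> a \<in> A \<and> dist (ifs_Phi f I a) y < 1 / Suc n" for n
  proof -
    have "y \<in> closure (?S n)" using y by blast
    moreover have "0 < 1 / real (Suc n)" by simp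
    ultimately have "\<exists>s\<in>?S n. dist s y < 1 / Suc n"
      unfolding closure_approachable by blast
    then show ?thesis by blast
  qed
  then obtain I a where Ia: "\<And>n. I n \<in> ifs_words m" "\<And>n. n \<le> length (I n)" "\<And>n. a n \<in> A"
    "\<And>n. dist (ifs_Phi f (I n) (a n)) y < 1 / Suc n"
    by metis
  show "y \<in> ifs_Omega m f A"
  proof (rule ifs_OmegaI)
    show "filterlim (\<lambda>n. length (I n)) at_top sequentially"
      using Ia(2) by (intro filterlim_at_top_mono[OF filterlim_ident]) auto
    have "(\<lambda>n. dist (ifs_Phi f (I n) (a n)) y) \<longlonglongrightarrow> 0"
      using Ia(4) by (intro LIMSEQ_norm_0) simp
    then show "(\<lambda>n. ifs_Phi f (I n) (a n)) \<longlonglongrightarrow> y"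
      by (simp add: tendsto_dist_iff[of _ y])
  qed (use Ia in auto)
qed

context
  fixes m :: nat and f :: "nat \<Rightarrow> 'a::metric_space \<Rightarrow> 'a" and N :: "'a set"
  assumes ifs: "ifs m f" and compact: "compact N" and inv: "forward_invariant m f N"
begin

lemma ifs_Omega_subset: "ifs_Omega m f N \<subseteq> N"
proof -
  \<comment> \<open>The member \<open>n = 0\<close> of the intersection already lies in
    \<open>N\<close>.\<close>
  have "{ifs_Phi f I a | I a. I \<in> ifs_words m \<and> 0 \<le> length I \<and> a \<in> N} \<subseteq> N"
    using forward_invariant_ifs_Phi[OF inv] by blast
  then have "closure {ifs_Phi f I a | I a. I \<in> ifs_words m \<and> 0 \<le> length I \<and> a \<in> N} \<subseteq> N"
    using compact compact_imp_closed closure_minimal by blast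
  then show ?thesis
    unfolding ifs_Omega_eq by blast
qed

lemma compact_ifs_Omega: "compact (ifs_Omega m f N)"
proof -
  have "closed (ifs_Omega m f N)"
    unfolding ifs_Omega_eq by blast
  then have "compact (N \<inter> ifs_Omega m f N)"
    using compact by (rule compact_Int_closed[rotated])
  then show ?thesis
    using ifs_Omega_subset by (simp add: Int_absorb1)
qed

text \<open>Compactness of \<open>N\<close> produces points of the limit set. The index map
  \<open>r\<close> is exposed so that other sequences can be followed along the same
  subsequence.\<close>

lemma ifs_Omega_subsequence:
  assumes Ia: "\<And>n::nat. I n \<in> ifs_words m" "\<And>n. a n \<in> N"
    and len: "filterlim (\<lambda>n. length (I n)) at_top sequentially"
  obtains z r where "z \<in> ifs_Omega m f N" and "strict_mono r"
    and "(\<lambda>n. ifs_Phi f (I (r n)) (a (r n))) \<longlonglongrightarrow> z"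
proof -
  have "\<forall>n. ifs_Phi f (I n) (a n) \<in> N"
    using Ia forward_invariant_ifs_Phi[OF inv] by blast
  then obtain z r where r: "strict_mono r"
    and z: "((\<lambda>n. ifs_Phi f (I n) (a n)) \<circ> r) \<longlonglongrightarrow> z"
    using compact unfolding compact_def by metis
  have "z \<in> ifs_Omega m f N"
  proof (rule ifs_OmegaI)
    show "filterlim (\<lambda>n. length ((I \<circ> r) n)) at_top sequentially"
      using filterlim_compose[OF len filterlim_subseq[OF r]] by simp
    show "(\<lambda>n. ifs_Phi f ((I \<circ> r) n) ((a \<circ> r) n)) \<longlonglongrightarrow> z"
      using z by (simp add: o_def)
  qed (use Ia in auto)
  with r z show ?thesis using that by (simp add: o_def)
qed

lemma ifs_Omega_nonempty:
  assumes "N \<noteq> {}"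
  shows "ifs_Omega m f N \<noteq> {}"
proof -
  obtain x where "x \<in> N" using assms by blast
  moreover have "replicate n 1 \<in> ifs_words m" for n
    using ifs by (auto simp: ifs_words_def ifs_def)
  moreover have "filterlim (\<lambda>n. length (replicate n (1::nat))) at_top sequentially"
    by (simp add: filterlim_ident)
  ultimately show ?thesis
    using ifs_Omega_subsequence[of "\<lambda>n. replicate n 1" "\<lambda>_. x"] by blast
qed

text \<open>Appending a letter to the words gives one inclusion. For the other, infinitely many
  words end in the same letter \<open>i\<close>; with it removed, a subsequence converges to some
  \<open>z\<close> in the limit set, and continuity gives \<open>y = f i z\<close>.\<close>

lemma H_invariant_ifs_Omega: "H_invariant m f (ifs_Omega m f N)"
  unfolding H_invariant_def
proof (intro equalityI subsetI)
  fix y assume "y \<in> hutchinson m f (ifs_Omega m f N)"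
  then obtain i z where i: "i \<in> {1..m}" and z: "z \<in> ifs_Omega m f N" and y: "y = f i z"
    by (auto simp: hutchinson_def)
  obtain I a where Ia: "\<forall>n::nat. I n \<in> ifs_words m \<and> a n \<in> N"
    and len: "filterlim (\<lambda>n. length (I n)) at_top sequentially"
    and lim: "(\<lambda>n. ifs_Phi f (I n) (a n)) \<longlonglongrightarrow> z"
    using z unfolding ifs_Omega_def by blast
  show "y \<in> ifs_Omega m f N"
  proof (rule ifs_OmegaI)
    show "I n @ [i] \<in> ifs_words m" "a n \<in> N" for n
      using Ia i by auto
    show "filterlim (\<lambda>n. length (I n @ [i])) at_top sequentially"
      by (rule filterlim_at_top_mono[OF len]) auto
    have cont: "continuous_on UNIV (f i)" using ifs i by (simp add: ifs_def)
    show "(\<lambda>n. ifs_Phi f (I n @ [i]) (a n)) \<longlonglongrightarrow> y"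
      using continuous_on_tendsto_compose[OF cont lim] by (simp add: y ifs_Phi_append)
  qed
next
  fix y assume "y \<in> ifs_Omega m f N"
  then obtain I a where Ia: "\<forall>n::nat. I n \<in> ifs_words m \<and> a n \<in> N"
    and len: "filterlim (\<lambda>n. length (I n)) at_top sequentially"
    and lim: "(\<lambda>n. ifs_Phi f (I n) (a n)) \<longlonglongrightarrow> y"
    unfolding ifs_Omega_def by blast
  \<comment> \<open>Early words may be empty and have no meaningful last letter.\<close>
  obtain n0 where n0: "\<And>n. n \<ge> n0 \<Longrightarrow> 1 \<le> length (I n)"
    using len by (metis filterlim_at_top eventually_sequentially)
  have "last (I n) \<in> {1..m}" if "n \<ge> n0" for n
    using Ia n0[OF that] unfolding ifs_words_def
    by (metis (mono_tags) last_in_set length_0_conv mem_Collect_eq not_one_le_zero subsetD)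
  then have "(\<lambda>n. last (I n)) ` {n0..} \<subseteq> {1..m}" by auto
  then obtain i where inf: "infinite {n \<in> {n0..}. last (I n) = i}"
    using pigeonhole_infinite[of "{n0..}" "\<lambda>n. last (I n)"]
    by (metis finite_atLeastAtMost finite_subset infinite_Ici)
  define s where "s = enumerate {n \<in> {n0..}. last (I n) = i}"
  have s: "strict_mono s"
    using inf by (simp add: s_def strict_mono_enumerate)
  have s_mem: "n0 \<le> s n" "last (I (s n)) = i" for n
    using enumerate_in_set[OF inf, of n] by (auto simp: s_def)
  have split: "I (s n) = butlast (I (s n)) @ [i]" for n
    using n0[OF s_mem(1)[of n]] s_mem(2)[of n]
    by (metis append_butlast_last_id length_0_conv not_one_le_zero)
  have words: "butlast (I (s n)) \<in> ifs_words m" and i: "i \<in> {1..m}" for n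
    using Ia split[of n] by (metis append_in_ifs_words Cons_in_ifs_words)+
  \<comment> \<open>These are the lengths of the shortened words.\<close>
  have "filterlim (\<lambda>n. length (I (s n)) - 1) at_top sequentially"
    using filterlim_compose[OF filterlim_minus_const_nat_at_top
        filterlim_compose[OF len filterlim_subseq[OF s]], of 1]
    by simp
  then obtain z r where z: "z \<in> ifs_Omega m f N" and r: "strict_mono r"
    and limz: "(\<lambda>n. ifs_Phi f (butlast (I (s (r n)))) (a (s (r n)))) \<longlonglongrightarrow> z"
    using ifs_Omega_subsequence[of "\<lambda>n. butlast (I (s n))" "\<lambda>n. a (s n)"] words Ia by auto
  have cont: "continuous_on UNIV (f i)" using ifs i by (simp add: ifs_def)
  have "(\<lambda>n. f i (ifs_Phi f (butlast (I (s (r n)))) (a (s (r n))))) \<longlonglongrightarrow> f i z"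
    using continuous_on_tendsto_compose[OF cont limz] by simp
  moreover have "f i (ifs_Phi f (butlast (I (s n))) (a (s n))) = ifs_Phi f (I (s n)) (a (s n))" for n
    \<comment> \<open>Only the full word on the right is rewritten; \<open>split\<close> repeats its
      left-hand side and would loop as a simplification rule.\<close>
    by (subst (2) split) (simp add: ifs_Phi_append)
  ultimately have "(\<lambda>n. ifs_Phi f (I (s (r n))) (a (s (r n)))) \<longlonglongrightarrow> f i z"
    by simp
  moreover have "(\<lambda>n. ifs_Phi f (I (s (r n))) (a (s (r n)))) \<longlonglongrightarrow> y"
    using LIMSEQ_subseq_LIMSEQ[OF lim strict_mono_o[OF s r]] by (simp add: o_def)
  ultimately have "y = f i z" by (rule LIMSEQ_unique[symmetric])
  with z i show "y \<in> hutchinson m f (ifs_Omega m f N)"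
    by (auto simp: hutchinson_def)
qed

end

section \<open>Maximality of the limit set and conclusion\<close>

text \<open>As \<open>B\<close> equals all its iterates, \<open>y\<close> has a preimage in
  \<open>B\<close> under some word of each length \<open>n\<close>. The constant sequence
  \<open>y\<close> then witnesses membership in the limit set.\<close>

lemma H_invariant_subset_ifs_Omega:
  assumes "H_invariant m f B" and "B \<subseteq> A"
  shows "B \<subseteq> ifs_Omega m f A"
proof
  fix y assume "y \<in> B"
  have "(hutchinson m f ^^ n) B = B" for n
    using assms(1) by (induction n) (simp_all add: H_invariant_def)
  then have "y \<in> (hutchinson m f ^^ n) B" for n
    using \<open>y \<in> B\<close> by simp
  then have "\<exists>I a. I \<in> ifs_words m \<and> length I = n \<and> a \<in> B \<and> y = ifs_Phi f I a" for n
    unfolding hutchinson_power_eq by blast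
  then obtain I a where Ia: "\<And>n. I n \<in> ifs_words m" "\<And>n. length (I n) = n" "\<And>n. a n \<in> B"
    "\<And>n. ifs_Phi f (I n) (a n) = y"
    by metis
  show "y \<in> ifs_Omega m f A"
    by (rule ifs_OmegaI[of I _ a]) (use Ia assms(2) in \<open>auto simp: filterlim_ident\<close>)
qed

theorem theorem4:
  fixes m :: nat and f :: "nat \<Rightarrow> 'a::metric_space \<Rightarrow> 'a" and N :: "'a set"
  assumes "separable_space (euclidean :: 'a topology)"
    and "locally_compact_space (euclidean :: 'a topology)"
    and "ifs m f"
    and "compact_dynamics m f"
    and "N \<in> orbitwise_chain_nodes m f"
  shows "forward_invariant m f N \<and>
    (ifs_Omega m f N \<noteq> {} \<and> compact (ifs_Omega m f N) \<and>
     H_invariant m f (ifs_Omega m f N) \<and> ifs_Omega m f N \<subseteq> N) \<and>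
    (\<forall>B. B \<noteq> {} \<and> compact B \<and> H_invariant m f B \<and> B \<subseteq> N \<longrightarrow> B \<subseteq> ifs_Omega m f N)"
proof -
  have inv: "forward_invariant m f N"
    using assms(5) by (rule forward_invariant_orbitwise_chain_node)
  have compact: "compact N"
    using assms(2-5) by (rule compact_orbitwise_chain_node)
  have "N \<noteq> {}"
    using orbitwise_chain_nodeE[OF assms(5)] by blast
  then show ?thesis
    using inv ifs_Omega_nonempty[OF assms(3) compact inv] compact_ifs_Omega[OF assms(3) compact inv]
      H_invariant_ifs_Omega[OF assms(3) compact inv] ifs_Omega_subset[OF assms(3) compact inv]
      H_invariant_subset_ifs_Omega[of m f _ N]
    by simp
qed

end
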